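(* Let $A$ and $B$ be finite sets of UTVPI constraints with integer constants, such that $A\wedge B$ is satisfiable over $\mathbb Q$ but unsatisfiable over $\mathbb Z$. Let $A',B'$ be their difference-logic encodings and let $C$ be a cycle of total weight $0$ in the constraint graph $G(A'\wedge B')$ (each edge labelled as coming from $A'$ or from $B'$; write $C_A$, $C_B$ for the $A'$- and $B'$-edges of $C$) that contains, each exactly once, the two vertices $x_i^+$ and $x_i^-$ of some variable $x_i$, such that the weight of the path $\pi$ from $x_i^-$ to $x_i^+$ along $C$ is odd, say $2k+1$. Suppose $x_i$ occurs in $A$ but not in $B$, and that neither $\pi$ nor the path from $x_i^+$ to $x_i^-$ along $C$ consists only of $C_A$-edges. Let $\overline C^P_B$ be the set of summary constraints of the maximal subpaths of $\pi$ consisting only of $C_B$-edges, and let $\overline P_B$ be the conjunction of the UTVPI constraints $\Upsilon(c)$ for $c\in\overline C^P_B$. Let $\overline C$ be the cycle obtained from $C$ by replacing $\pi$ with the single edge $x_i^-\xrightarrow{2k}x_i^+$ (the constraint $(0\le x_i^+-x_i^-+2k)$), labelled as an $A'$-edge, the remaining edges keeping their labels. Let $I'$ be the difference-logic interpolant computed from $\overline C$, namely $I'=\bot$ if all edges of $\overline C$ are $A'$-edges, and otherwise the conjunction of the summary constraints of the maximal $A'$-paths of $\overline C$; let $I=\Upsilon(I')$. Then $(\overline P_B\rightarrow I)$ is an interpolant for $(A,B)$ over the integers.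
   Context: A UTVPI constraint is $(0\le a x + b y + k)$ with $a,b\in\{-1,0,1\}$. For each variable $x$ there are difference-logic variables $x^+,x^-$, with $\Upsilon(x^+)=x$, $\Upsilon(x^-)=-x$; write $v(x)=x^+$, $v(-x)=x^-$ for signed variables. Encoding: $(0\le s_1+s_2+k)$ with $s_1,s_2$ signed occurrences of distinct variables becomes $(0\le v(s_1)-v(-s_2)+k)$ and $(0\le v(s_2)-v(-s_1)+k)$; $(0\le s+k)$ becomes $(0\le v(s)-v(-s)+2k)$. $\Upsilon(0\le v-u+k)=(0\le\Upsilon(v)-\Upsilon(u)+k)$, extended to conjunctions, with $\Upsilon(\bot)=\bot$. The graph has an edge $u\xrightarrow{c}v$ per constraint $(0\le v-u+c)$. The summary constraint of a path $u_1\xrightarrow{c_1}\cdots\xrightarrow{c_{n-1}}u_n$ is $(0\le u_n-u_1+\sum c_j)$. A maximal $A'$-path of a cycle is a maximal path of consecutive $A'$-edges preceded and followed in the cycle by $B'$-edges. An interpolant for $(A,B)$ over the integers is a formula $I$ with $A\models I$ and $I\wedge B$ unsatisfiable (variables ranging over $\mathbb Z$), and every variable of $I$ occurring in both $A$ and $B$. *)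

theory Defs
  imports Complex_Main
begin

section \<open>UTVPI constraints\<close>

text \<open>\<open>Utvpi a x b y k\<close> stands for \<open>0 \<le> a x + b y + k\<close>. The restrictions on the coefficients are
  imposed by \<open>utvpi\<close>: the images of difference constraints under \<open>\<Upsilon>\<close> below live in the same
  datatype, but may mention the same variable twice (\<open>0 \<le> x + x + k\<close>).\<close>

datatype 'v lin = Utvpi int 'v int 'v int

fun utvpi :: "'v lin \<Rightarrow> bool" where
  "utvpi (Utvpi a x b y k) \<longleftrightarrow>
     a \<in> {-1, 0, 1} \<and> b \<in> {-1, 0, 1} \<and> (a \<noteq> 0 \<and> b \<noteq> 0 \<longrightarrow> x \<noteq> y)"

fun sat :: "('v \<Rightarrow> 'a::linordered_idom) \<Rightarrow> 'v lin \<Rightarrow> bool" where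
  "sat \<sigma> (Utvpi a x b y k) \<longleftrightarrow> 0 \<le> of_int a * \<sigma> x + of_int b * \<sigma> y + of_int k"

fun lin_vars :: "'v lin \<Rightarrow> 'v set" where
  "lin_vars (Utvpi a x b y k) = (if a \<noteq> 0 then {x} else {}) \<union> (if b \<noteq> 0 then {y} else {})"

section \<open>Difference logic and the encoding\<close>

text \<open>\<open>Pos x\<close> and \<open>Neg x\<close> are the difference-logic variables \<open>x\<^sup>+\<close> and \<open>x\<^sup>-\<close>.\<close>

datatype 'v dlvar = Pos (base: 'v) | Neg (base: 'v)

text \<open>\<open>Diff v u k\<close> stands for \<open>0 \<le> v - u + k\<close>; as an edge it runs from \<open>u\<close> to \<open>v\<close> with weight \<open>k\<close>.\<close>

datatype 'n diff = Diff (tgt: 'n) (src: 'n) (weight: int)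

text \<open>The map \<open>v\<close> on signed variables; a signed variable is given by its sign \<open>a \<in> {-1, 1}\<close> and
  its variable.\<close>

definition dl_var :: "int \<Rightarrow> 'v \<Rightarrow> 'v dlvar" where
  "dl_var a x = (if a = 1 then Pos x else Neg x)"

text \<open>A variable-free constraint \<open>0 \<le> k\<close> contributes no difference constraint.\<close>

fun encode :: "'v lin \<Rightarrow> 'v dlvar diff set" where
  "encode (Utvpi a x b y k) =
     (if a \<noteq> 0 \<and> b \<noteq> 0 then
        {Diff (dl_var a x) (dl_var (- b) y) k, Diff (dl_var b y) (dl_var (- a) x) k}
      else if a \<noteq> 0 then {Diff (dl_var a x) (dl_var (- a) x) (2 * k)}
      else if b \<noteq> 0 then {Diff (dl_var b y) (dl_var (- b) y) (2 * k)}
      else {})"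

definition encoding :: "'v lin set \<Rightarrow> 'v dlvar diff set" where
  "encoding A = (\<Union>c\<in>A. encode c)"

fun sign :: "'v dlvar \<Rightarrow> int" where
  "sign (Pos x) = 1"
| "sign (Neg x) = -1"

fun upsilon :: "'v dlvar diff \<Rightarrow> 'v lin" where
  "upsilon (Diff v u k) = Utvpi (sign v) (base v) (- sign u) (base u) k"

section \<open>Formulas and interpolants\<close>

text \<open>The extension of \<open>\<Upsilon>\<close> to formulas is \<open>map_fm upsilon\<close>.\<close>

datatype (atoms: 'a) fm = Bot | Atom 'a | Conj "'a fm list" | Imp "'a fm" "'a fm"
  for map: map_fm

fun holds :: "('a \<Rightarrow> bool) \<Rightarrow> 'a fm \<Rightarrow> bool" where
  "holds P Bot \<longleftrightarrow> False"
| "holds P (Atom a) \<longleftrightarrow> P a"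
| "holds P (Conj fs) \<longleftrightarrow> (\<forall>f\<in>set fs. holds P f)"
| "holds P (Imp f g) \<longleftrightarrow> (holds P f \<longrightarrow> holds P g)"

text \<open>Conjunction of a finite set of atoms, in some arbitrary order.\<close>

definition conj_of :: "'a set \<Rightarrow> 'a fm" where
  "conj_of S = Conj (map Atom (SOME cs. set cs = S \<and> distinct cs))"

definition int_interpolant :: "'v lin set \<Rightarrow> 'v lin set \<Rightarrow> 'v lin fm \<Rightarrow> bool" where
  "int_interpolant A B I \<longleftrightarrow>
     (\<forall>\<sigma> :: 'v \<Rightarrow> int. (\<forall>c\<in>A. sat \<sigma> c) \<longrightarrow> holds (sat \<sigma>) I) \<and>
     \<not> (\<exists>\<sigma> :: 'v \<Rightarrow> int. holds (sat \<sigma>) I \<and> (\<forall>c\<in>B. sat \<sigma> c)) \<and>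
     \<Union> (lin_vars ` atoms I) \<subseteq> \<Union> (lin_vars ` A) \<inter> \<Union> (lin_vars ` B)"

section \<open>Labelled constraint graphs\<close>

datatype side = SideA | SideB

type_synonym 'n edge = "side \<times> 'n diff"

abbreviation side :: "'n edge \<Rightarrow> side" where "side e \<equiv> fst e"
abbreviation esrc :: "'n edge \<Rightarrow> 'n" where "esrc e \<equiv> src (snd e)"
abbreviation etgt :: "'n edge \<Rightarrow> 'n" where "etgt e \<equiv> tgt (snd e)"

text \<open>A constraint belonging to both sides yields two parallel edges with different labels.\<close>

definition constraint_graph :: "'n diff set \<Rightarrow> 'n diff set \<Rightarrow> 'n edge set" where
  "constraint_graph A' B' = {SideA} \<times> A' \<union> {SideB} \<times> B'"

fun path :: "'n \<Rightarrow> 'n edge list \<Rightarrow> 'n \<Rightarrow> bool" where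
  "path u [] v \<longleftrightarrow> u = v"
| "path u (e # es) v \<longleftrightarrow> esrc e = u \<and> path (etgt e) es v"

text \<open>Cycles are closed walks, listed from an arbitrary starting point; vertices may repeat.\<close>

definition cycle :: "'n edge list \<Rightarrow> bool" where
  "cycle C \<longleftrightarrow> C \<noteq> [] \<and> path (esrc (hd C)) C (esrc (hd C))"

definition path_weight :: "'n edge list \<Rightarrow> int" where
  "path_weight p = (\<Sum>e\<leftarrow>p. weight (snd e))"

text \<open>Only meaningful for nonempty paths.\<close>

definition summary :: "'n edge list \<Rightarrow> 'n diff" where
  "summary p = Diff (etgt (last p)) (esrc (hd p)) (path_weight p)"

text \<open>Rotating the cycle so that it starts with \<open>p\<close>, the edge following \<open>p\<close> in the cycle is the
  head of the remainder and the edge preceding \<open>p\<close> is its last element (possibly the same edge).\<close>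

definition maximal_A_path :: "'n edge list \<Rightarrow> 'n edge list \<Rightarrow> bool" where
  "maximal_A_path C p \<longleftrightarrow>
     p \<noteq> [] \<and> (\<forall>e\<in>set p. side e = SideA) \<and>
     (\<exists>n rest. rotate n C = p @ rest \<and> rest \<noteq> [] \<and>
        side (hd rest) = SideB \<and> side (last rest) = SideB)"

definition maximal_B_subpath :: "'n edge list \<Rightarrow> 'n edge list \<Rightarrow> bool" where
  "maximal_B_subpath p q \<longleftrightarrow>
     q \<noteq> [] \<and> (\<forall>e\<in>set q. side e = SideB) \<and>
     (\<exists>p1 p2. p = p1 @ q @ p2 \<and>
        (p1 \<noteq> [] \<longrightarrow> side (last p1) = SideA) \<and> (p2 \<noteq> [] \<longrightarrow> side (hd p2) = SideA))"

definition dl_interpolant :: "'n edge list \<Rightarrow> 'n diff fm" where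
  "dl_interpolant C =
     (if \<forall>e\<in>set C. side e = SideA then Bot
      else conj_of (summary ` {p. maximal_A_path C p}))"

end

(*
  Read an integer valuation \<sigma> as the potential x^+ = \<sigma> x, x^- = - \<sigma> x on the constraint graph.
  A model of A and P_B makes the path \<pi> valid, i.e. 0 \<le> 2 x + 2 k + 1; by parity 0 \<le> 2 x + 2 k, so
  the tightened edge of the shortened cycle is valid and with it every maximal A'-path. A model of B
  makes P_B valid, so with P_B \<longrightarrow> I all edges and A'-paths of the shortened cycle would be
  valid, although its weight is 2 k - (2 k + 1) = -1. The endpoints of the summarised paths lie between
  an A'-edge and a B'-edge, except for x itself, which occurs in A.
*)
theory Submission
  imports Defs
begin

section \<open>Formulas and finite conjunctions\<close>

lemma holds_map_fm: "holds P (map_fm f F) \<longleftrightarrow> holds (P \<circ> f) F"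
  by (induction F) auto

text \<open>Finiteness guarantees a distinct enumeration, so the choice inside
  \<open>conj_of\<close> has a witness. Hence the sets of summarised paths must be shown finite
  below.\<close>

lemma set_some_distinct:
  assumes "finite S"
  shows "set (SOME cs. set cs = S \<and> distinct cs) = S"
  using someI_ex[OF finite_distinct_list[OF assms]] by simp

lemma holds_conj_of: "finite S \<Longrightarrow> holds P (conj_of S) \<longleftrightarrow> (\<forall>a\<in>S. P a)"
  by (simp add: conj_of_def set_some_distinct)

lemma atoms_conj_of: "finite S \<Longrightarrow> atoms (conj_of S) = S"
  by (simp add: conj_of_def set_some_distinct)

section \<open>Potentials and soundness of the encoding\<close>

definition diff_sat :: "('n \<Rightarrow> int) \<Rightarrow> 'n diff \<Rightarrow> bool" where
  "diff_sat \<tau> d \<longleftrightarrow> 0 \<le> \<tau> (tgt d) - \<tau> (src d) + weight d"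

definition dl_valuation :: "('v \<Rightarrow> int) \<Rightarrow> 'v dlvar \<Rightarrow> int" where
  "dl_valuation \<sigma> v = sign v * \<sigma> (base v)"

text \<open>This bridge lets the truth of \<open>P_B\<close> and \<open>I\<close> be checked on the
  graph, under the potential induced by \<open>\<sigma>\<close>.\<close>

lemma sat_upsilon: "sat \<sigma> (upsilon d) \<longleftrightarrow> diff_sat (dl_valuation \<sigma>) d"
  by (cases d) (simp add: diff_sat_def dl_valuation_def)

text \<open>Occurrence is syntactic: the coefficients are signs and never 0, so even
  \<open>0 \<le> x - x + k\<close> mentions \<open>x\<close>.\<close>

lemma lin_vars_upsilon: "lin_vars (upsilon d) = {base (tgt d), base (src d)}"
proof -
  have "sign v \<noteq> 0" for v :: "'a dlvar" by (cases v) auto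
  then show ?thesis by (cases d) auto
qed

text \<open>Under the induced potential, both differences of a two-variable constraint unfold to the
  constraint itself, and a one-variable constraint is doubled. \<open>utvpi\<close> rules out
  coefficients that \<open>dl_var\<close> would misread as -1.\<close>

lemma encode_sound:
  fixes \<sigma> :: "'v \<Rightarrow> int"
  assumes "utvpi c" "sat \<sigma> c" "d \<in> encode c"
  shows "diff_sat (dl_valuation \<sigma>) d"
  using assms
  by (cases c) (auto simp: diff_sat_def dl_valuation_def dl_var_def split: if_splits)

lemma encoding_sound:
  fixes \<sigma> :: "'v \<Rightarrow> int"
  assumes "\<forall>c\<in>A. utvpi c" "\<forall>c\<in>A. sat \<sigma> c" "d \<in> encoding A"
  shows "diff_sat (dl_valuation \<sigma>) d"
  using assms encode_sound unfolding encoding_def by blast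

lemma base_dl_var [simp]: "base (dl_var a x) = x"
  by (simp add: dl_var_def)

lemma encode_vars: "d \<in> encode c \<Longrightarrow> {base (tgt d), base (src d)} \<subseteq> lin_vars c"
  by (cases c) (auto split: if_splits)

lemma encoding_vars:
  "d \<in> encoding A \<Longrightarrow> {base (tgt d), base (src d)} \<subseteq> \<Union> (lin_vars ` A)"
  using encode_vars unfolding encoding_def by blast

section \<open>Paths, rotations and summaries\<close>

lemma path_append: "path u (p @ q) w \<longleftrightarrow> (\<exists>v. path u p v \<and> path v q w)"
  by (induction p arbitrary: u) auto

lemma path_hd: "path u p v \<Longrightarrow> p \<noteq> [] \<Longrightarrow> esrc (hd p) = u"
  by (cases p) auto

lemma path_last: "path u p v \<Longrightarrow> p \<noteq> [] \<Longrightarrow> etgt (last p) = v"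
  by (induction p arbitrary: u) auto

lemma path_joint:
  assumes "path u (p @ q) v" "p \<noteq> []" "q \<noteq> []"
  shows "etgt (last p) = esrc (hd q)"
proof -
  obtain w where "path u p w" "path w q v"
    using assms(1) by (auto simp: path_append)
  then show ?thesis
    using assms(2,3) path_last path_hd by metis
qed

lemma path_rotate: "path u p u \<Longrightarrow> \<exists>v. path v (rotate n p) v"
proof (induction n)
  case 0
  then show ?case by auto
next
  case (Suc n)
  then obtain v where v: "path v (rotate n p) v" by auto
  then show ?case
    by (cases "rotate n p") (auto simp: path_append)
qed

lemma path_weight_append: "path_weight (p @ q) = path_weight p + path_weight q"
  by (simp add: path_weight_def)

lemma path_weight_rotate: "path_weight (rotate n p) = path_weight p"
proof (induction n)
  case (Suc n)
  then show ?case by (cases "rotate n p") (auto simp: path_weight_def)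
qed simp

text \<open>Adding up the edge constraints telescopes the potential differences.\<close>

lemma path_sound:
  assumes "path u p v" "\<forall>e\<in>set p. diff_sat \<tau> (snd e)"
  shows "0 \<le> \<tau> v - \<tau> u + path_weight p"
  using assms
proof (induction p arbitrary: u)
  case Nil
  then show ?case by (simp add: path_weight_def)
next
  case (Cons e p)
  then have "0 \<le> \<tau> v - \<tau> (etgt e) + path_weight p" by auto
  then show ?case
    using Cons.prems by (simp add: path_weight_def diff_sat_def)
qed

lemma diff_sat_summary:
  assumes "path u p v" "p \<noteq> []"
  shows "diff_sat \<tau> (summary p) \<longleftrightarrow> 0 \<le> \<tau> v - \<tau> u + path_weight p"
  using path_hd[OF assms] path_last[OF assms] by (simp add: diff_sat_def summary_def)

lemma summary_sound:
  assumes "path u p v" "p \<noteq> []" "\<forall>e\<in>set p. diff_sat \<tau> (snd e)"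
  shows "diff_sat \<tau> (summary p)"
  using path_sound[OF assms(1,3)] diff_sat_summary[OF assms(1,2)] by simp

section \<open>Decomposition of paths into maximal runs\<close>

definition maximal_run :: "('e \<Rightarrow> bool) \<Rightarrow> 'e list \<Rightarrow> 'e list \<Rightarrow> 'e list \<Rightarrow> 'e list \<Rightarrow> bool" where
  "maximal_run P p l q r \<longleftrightarrow> p = l @ q @ r \<and> q \<noteq> [] \<and> (\<forall>e\<in>set q. P e) \<and>
     (l \<noteq> [] \<longrightarrow> \<not> P (last l)) \<and> (r \<noteq> [] \<longrightarrow> \<not> P (hd r))"

text \<open>The telescoping sum survives when whole runs of \<open>P\<close>-edges are known only
  through their summaries. \<open>P\<close> selects B-edges along \<open>\<pi>\<close> and A-edges
  around the shortened cycle. Induction is on length because a step may consume an entire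
  run.\<close>

lemma path_sound_runs:
  assumes "path u p v"
    and "\<forall>e\<in>set p. \<not> P e \<longrightarrow> diff_sat \<tau> (snd e)"
    and "\<And>l q r. maximal_run P p l q r \<Longrightarrow> diff_sat \<tau> (summary q)"
  shows "0 \<le> \<tau> v - \<tau> u + path_weight p"
  using assms
proof (induction "length p" arbitrary: u p rule: less_induct)
  case less
  show ?case
  proof (cases p)
    case Nil
    then show ?thesis using less.prems(1) by (simp add: path_weight_def)
  next
    case (Cons e p')
    show ?thesis
    proof (cases "P e")
      case False
      \<comment> \<open>As \<open>e\<close> fails \<open>P\<close>, putting it in front of the left
        context keeps the run maximal.\<close>
      have "diff_sat \<tau> (summary q)" if "maximal_run P p' l q r" for l q r
        using less.prems(3)[of "e # l" q r] that Cons False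
        by (simp add: maximal_run_def)
      then have "0 \<le> \<tau> v - \<tau> (etgt e) + path_weight p'"
        using less.hyps[of p' "etgt e"] less.prems(1,2) Cons by simp
      then show ?thesis
        using less.prems(1,2) Cons False by (simp add: path_weight_def diff_sat_def)
    next
      case True
      define q where "q = takeWhile P p"
      define s where "s = dropWhile P p"
      have p: "p = q @ s" by (simp add: q_def s_def)
      have q: "q \<noteq> []" "\<forall>e\<in>set q. P e"
        using Cons True by (auto simp: q_def dest: set_takeWhileD)
      have s: "s \<noteq> [] \<longrightarrow> \<not> P (hd s)"
        unfolding s_def using hd_dropWhile by blast
      obtain w where w: "path u q w" "path w s v"
        using less.prems(1) p by (auto simp: path_append)
      have "diff_sat \<tau> (summary q)"
        by (rule less.prems(3)[of "[]" q s]) (use p q s in \<open>auto simp: maximal_run_def\<close>)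
      then have 1: "0 \<le> \<tau> w - \<tau> u + path_weight q"
        using diff_sat_summary[OF w(1) q(1)] by simp
      have "diff_sat \<tau> (summary q')" if run: "maximal_run P s l q' r" for l q' r
      proof -
        \<comment> \<open>\<open>s\<close> starts with an edge failing \<open>P\<close>, so no run
          of \<open>s\<close> begins there; prefixing \<open>q\<close> therefore cannot extend the
          run.\<close>
        have "l \<noteq> []"
        proof
          assume "l = []"
          then have "hd s \<in> set q'" "s \<noteq> []" using run by (auto simp: maximal_run_def)
          then show False using s run by (auto simp: maximal_run_def)
        qed
        then have "maximal_run P p (q @ l) q' r"
          using run p by (simp add: maximal_run_def)
        then show ?thesis using less.prems(3) by blast
      qed
      then have "0 \<le> \<tau> v - \<tau> w + path_weight s"
        using less.hyps[of s w] less.prems(2) w(2) p q(1) by simp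
      then show ?thesis using 1 p by (simp add: path_weight_append)
    qed
  qed
qed

lemma maximal_B_subpath_iff:
  "maximal_B_subpath p q \<longleftrightarrow> (\<exists>l r. maximal_run (\<lambda>e. side e = SideB) p l q r)"
proof -
  have "s = SideA \<longleftrightarrow> s \<noteq> SideB" for s by (cases s) auto
  then show ?thesis by (auto simp: maximal_B_subpath_def maximal_run_def)
qed

text \<open>Once the listing starts with a B-edge, no A-run wraps around its seam, so linear and
  cyclic maximality agree.\<close>

lemma maximal_run_rotate_A_path:
  assumes run: "maximal_run (\<lambda>e. side e = SideA) (rotate n C) l p r"
    and B: "rotate n C \<noteq> []" "side (hd (rotate n C)) = SideB"
  shows "maximal_A_path C p"
proof -
  have not_A: "s = SideB \<longleftrightarrow> s \<noteq> SideA" for s by (cases s) auto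
  have eq: "rotate n C = l @ p @ r" and p: "p \<noteq> []" "\<forall>e\<in>set p. side e = SideA"
    using run by (auto simp: maximal_run_def)
  have l: "l \<noteq> []"
    using B(2) eq p by (auto simp: not_A)
  have last: "side (last (r @ l)) = SideB"
    using run l by (simp add: maximal_run_def not_A)
  \<comment> \<open>If \<open>r\<close> is empty, the cyclic successor of \<open>p\<close> is the
    B-edge that opens the listing.\<close>
  have hd: "side (hd (r @ l)) = SideB"
    using run l B(2) eq by (cases "r = []") (auto simp: maximal_run_def not_A)
  have "rotate (length l + n) C = p @ r @ l"
    using rotate_rotate[of "length l" n C] eq rotate_append[of l "p @ r"] by simp
  then show ?thesis
    using p l last hd unfolding maximal_A_path_def by blast
qed

section \<open>Finiteness of the summary sets and the cycle inequality\<close>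

lemma finite_maximal_B_subpaths: "finite {q. maximal_B_subpath p q}"
proof (rule finite_subset)
  show "{q. maximal_B_subpath p q} \<subseteq> {q. set q \<subseteq> set p \<and> length q \<le> length p}"
    by (auto simp: maximal_B_subpath_def)
qed (simp add: finite_lists_length_le)

lemma maximal_A_path_subset:
  assumes "maximal_A_path C p"
  shows "set p \<subseteq> set C" "length p \<le> length C"
proof -
  obtain n rest where "rotate n C = p @ rest"
    using assms by (auto simp: maximal_A_path_def)
  then show "set p \<subseteq> set C" "length p \<le> length C"
    by (metis set_rotate set_append Un_upper1, metis length_rotate length_append le_add1)
qed

lemma finite_maximal_A_paths: "finite {p. maximal_A_path C p}"
proof (rule finite_subset)
  show "{p. maximal_A_path C p} \<subseteq> {p. set p \<subseteq> set C \<and> length p \<le> length C}"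
    using maximal_A_path_subset by blast
qed (simp add: finite_lists_length_le)

lemma maximal_A_path_path:
  assumes "path u C u" "maximal_A_path C p"
  obtains v w where "path v p w"
proof -
  obtain n rest where "rotate n C = p @ rest"
    using assms by (auto simp: maximal_A_path_def)
  then show thesis
    using path_rotate[OF assms(1), of n] that by (auto simp: path_append)
qed

text \<open>Refutation principle of the difference-logic interpolant: on a negative cycle, the
  A-path summaries contradict the B-edges. Rotating to a B-edge reduces this to a linear
  decomposition into runs.\<close>

lemma dl_cycle_sound:
  assumes cyc: "path u C u"
    and B: "e \<in> set C" "side e = SideB"
    and B_sat: "\<forall>e\<in>set C. side e = SideB \<longrightarrow> diff_sat \<tau> (snd e)"
    and A_sat: "\<And>p. maximal_A_path C p \<Longrightarrow> diff_sat \<tau> (summary p)"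
  shows "0 \<le> path_weight C"
proof -
  have not_A: "s = SideB \<longleftrightarrow> s \<noteq> SideA" for s by (cases s) auto
  obtain C1 C2 where C: "C = C1 @ e # C2" using split_list[OF B(1)] by blast
  define n where "n = length C1"
  have rot: "rotate n C = e # C2 @ C1"
    by (simp add: C n_def rotate_append)
  obtain v where v: "path v (rotate n C) v" using path_rotate[OF cyc] by blast
  \<comment> \<open>The walk is closed, so the potentials cancel and only the weight
    remains.\<close>
  have "0 \<le> \<tau> v - \<tau> v + path_weight (rotate n C)"
  proof (rule path_sound_runs[OF v])
    show "\<forall>e\<in>set (rotate n C). side e \<noteq> SideA \<longrightarrow> diff_sat \<tau> (snd e)"
      using B_sat by (simp add: not_A)
    show "diff_sat \<tau> (summary q)"
      if "maximal_run (\<lambda>e. side e = SideA) (rotate n C) l q r" for l q r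
      by (rule A_sat, rule maximal_run_rotate_A_path[OF that]) (simp_all add: rot B(2))
  qed
  then show ?thesis by (simp add: path_weight_rotate)
qed

section \<open>Interpolation over the integers\<close>

theorem mainTheorem11:
  fixes A B :: "'v lin set"
    and C \<pi> \<rho> C_bar :: "'v dlvar edge list"
    and x :: 'v and k :: int and n :: nat
    and P_B I :: "'v lin fm"
  assumes "finite A" and "finite B"
    and "\<forall>c\<in>A. utvpi c" and "\<forall>c\<in>B. utvpi c"
    and "\<exists>\<sigma> :: 'v \<Rightarrow> rat. \<forall>c\<in>A \<union> B. sat \<sigma> c"
    and "\<not> (\<exists>\<sigma> :: 'v \<Rightarrow> int. \<forall>c\<in>A \<union> B. sat \<sigma> c)"
    and "cycle C"
    and "set C \<subseteq> constraint_graph (encoding A) (encoding B)"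
    and "path_weight C = 0"
    and "count_list (map esrc C) (Pos x) = 1"
    and "count_list (map esrc C) (Neg x) = 1"
    and "rotate n C = \<pi> @ \<rho>"
    and "path (Neg x) \<pi> (Pos x)"
    and "path (Pos x) \<rho> (Neg x)"
    and "path_weight \<pi> = 2 * k + 1"
    and "x \<in> \<Union> (lin_vars ` A)" and "x \<notin> \<Union> (lin_vars ` B)"
    and "\<not> (\<forall>e\<in>set \<pi>. side e = SideA)"
    and "\<not> (\<forall>e\<in>set \<rho>. side e = SideA)"
    and "P_B = conj_of (upsilon ` summary ` {q. maximal_B_subpath \<pi> q})"
    and "C_bar = (SideA, Diff (Pos x) (Neg x) (2 * k)) # \<rho>"
    and "I = map_fm upsilon (dl_interpolant C_bar)"
  shows "int_interpolant A B (Imp P_B I)"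
proof -
  note utvpi_A = assms(3) and utvpi_B = assms(4) and C_edges = assms(8) and rot = assms(12)
    and path_pi = assms(13) and path_rho = assms(14) and weight_pi = assms(15)
    and x_A = assms(16) and rho_not_A = assms(19)
  let ?VA = "\<Union> (lin_vars ` A)" and ?VB = "\<Union> (lin_vars ` B)"
  have weight_C: "path_weight \<pi> + path_weight \<rho> = 0"
    using assms(9) path_weight_rotate[of n C] rot by (simp add: path_weight_append)
  have set_C: "set \<pi> \<union> set \<rho> = set C"
    using arg_cong[OF rot, of set] by simp
  have A_edge: "snd e \<in> encoding A" if "e \<in> set \<pi> \<union> set \<rho>" "side e = SideA" for e
    using that set_C C_edges by (auto simp: constraint_graph_def)
  have B_edge: "snd e \<in> encoding B" if "e \<in> set \<pi> \<union> set \<rho>" "side e = SideB" for e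
    using that set_C C_edges by (auto simp: constraint_graph_def)
  have not_A: "s = SideB \<longleftrightarrow> s \<noteq> SideA" for s by (cases s) auto
  have cyc: "path (Neg x) C_bar (Neg x)"
    using path_rho assms(21) by simp
  have weight_C_bar: "path_weight C_bar = -1"
    using assms(21) weight_C weight_pi by (simp add: path_weight_def)
  \<comment> \<open>The new edge is labelled A, so this B-edge comes from \<open>\<rho>\<close>. It
    excludes the \<open>Bot\<close> case of \<open>dl_interpolant\<close> and serves as the starting
    point in \<open>dl_cycle_sound\<close>.\<close>
  obtain b where b: "b \<in> set C_bar" "side b = SideB"
    using rho_not_A assms(21) by (auto simp: not_A)
  have C_bar_B: "e \<in> set \<rho>" if "e \<in> set C_bar" "side e = SideB" for e
    using that assms(21) by auto
  define S where "S = upsilon ` summary ` {q. maximal_B_subpath \<pi> q}"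
  define T where "T = summary ` {p. maximal_A_path C_bar p}"
  have fin_S: "finite S" unfolding S_def by (intro finite_imageI finite_maximal_B_subpaths)
  have fin_T: "finite T" unfolding T_def by (intro finite_imageI finite_maximal_A_paths)
  have P_B: "P_B = conj_of S" using assms(20) by (simp add: S_def)
  have "dl_interpolant C_bar = conj_of T"
    using b unfolding dl_interpolant_def T_def by (metis side.distinct(1))
  then have I: "I = map_fm upsilon (conj_of T)" using assms(22) by simp
  have holds_P_B: "holds (sat \<sigma>) P_B \<longleftrightarrow>
      (\<forall>q. maximal_B_subpath \<pi> q \<longrightarrow> diff_sat (dl_valuation \<sigma>) (summary q))"
    for \<sigma> :: "'v \<Rightarrow> int"
    unfolding P_B holds_conj_of[OF fin_S] by (auto simp: S_def sat_upsilon)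
  have holds_I: "holds (sat \<sigma>) I \<longleftrightarrow>
      (\<forall>p. maximal_A_path C_bar p \<longrightarrow> diff_sat (dl_valuation \<sigma>) (summary p))"
    for \<sigma> :: "'v \<Rightarrow> int"
    unfolding I holds_map_fm holds_conj_of[OF fin_T] by (auto simp: T_def sat_upsilon)

  have A_implies: "holds (sat \<sigma>) (Imp P_B I)" if \<sigma>: "\<forall>c\<in>A. sat \<sigma> c" for \<sigma> :: "'v \<Rightarrow> int"
  proof -
    let ?\<tau> = "dl_valuation \<sigma>"
    have sat_A: "diff_sat ?\<tau> (snd e)" if "e \<in> set \<pi> \<union> set \<rho>" "side e = SideA" for e
      using encoding_sound[OF utvpi_A \<sigma> A_edge[OF that]] .
    have "diff_sat ?\<tau> (summary p)"
      if P: "holds (sat \<sigma>) P_B" and p: "maximal_A_path C_bar p" for p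
    proof -
      \<comment> \<open>Along \<open>\<pi>\<close>, the A-edges hold by the model of
        \<open>A\<close> and the B-runs by \<open>P_B\<close>.\<close>
      have "0 \<le> ?\<tau> (Pos x) - ?\<tau> (Neg x) + path_weight \<pi>"
      proof (rule path_sound_runs[OF path_pi])
        show "\<forall>e\<in>set \<pi>. side e \<noteq> SideB \<longrightarrow> diff_sat ?\<tau> (snd e)"
          using sat_A not_A by blast
        show "diff_sat ?\<tau> (summary q)"
          if "maximal_run (\<lambda>e. side e = SideB) \<pi> l q r" for l q r
          using P that unfolding holds_P_B maximal_B_subpath_iff by blast
      qed
      then have "0 \<le> 2 * \<sigma> x + 2 * k + 1"
        using weight_pi by (simp add: dl_valuation_def)
      \<comment> \<open>Integrality enters here: the even number \<open>2 * (\<sigma> x + k)\<close>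
        is at least -1, hence at least 0.\<close>
      then have "0 \<le> \<sigma> x + k" by presburger
      then have new: "diff_sat ?\<tau> (Diff (Pos x) (Neg x) (2 * k))"
        by (simp add: diff_sat_def dl_valuation_def)
      obtain v w where vw: "path v p w" using maximal_A_path_path[OF cyc p] .
      have "p \<noteq> []" and side_p: "\<forall>e\<in>set p. side e = SideA"
        using p by (auto simp: maximal_A_path_def)
      \<comment> \<open>Each edge of \<open>p\<close> is the tightened edge or an original A-edge of
        \<open>\<rho>\<close>.\<close>
      moreover have "\<forall>e\<in>set p. diff_sat ?\<tau> (snd e)"
        using side_p maximal_A_path_subset(1)[OF p] assms(21) new sat_A by fastforce
      ultimately show ?thesis using summary_sound[OF vw] by blast
    qed
    then show ?thesis by (auto simp: holds_I)
  qed

  have B_refutes: False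
    if imp: "holds (sat \<sigma>) (Imp P_B I)" and \<sigma>: "\<forall>c\<in>B. sat \<sigma> c" for \<sigma> :: "'v \<Rightarrow> int"
  proof -
    let ?\<tau> = "dl_valuation \<sigma>"
    have sat_B: "diff_sat ?\<tau> (snd e)" if "e \<in> set \<pi> \<union> set \<rho>" "side e = SideB" for e
      using encoding_sound[OF utvpi_B \<sigma> B_edge[OF that]] .
    \<comment> \<open>B-runs consist of edges valid in every model of \<open>B\<close>, so
      \<open>P_B\<close> holds and the implication yields \<open>I\<close>.\<close>
    have "diff_sat ?\<tau> (summary q)" if q: "maximal_B_subpath \<pi> q" for q
    proof -
      obtain l r where lr: "\<pi> = l @ q @ r" "q \<noteq> []" "\<forall>e\<in>set q. side e = SideB"
        using q by (auto simp: maximal_B_subpath_def)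
      then obtain v w where "path v q w" using path_pi by (auto simp: path_append)
      then show ?thesis using lr sat_B by (auto intro!: summary_sound)
    qed
    then have "holds (sat \<sigma>) I" using imp by (simp add: holds_P_B)
    then have "0 \<le> path_weight C_bar"
      using dl_cycle_sound[OF cyc b, of ?\<tau>] sat_B C_bar_B by (simp add: holds_I)
    then show False using weight_C_bar by simp
  qed

  have vars_P_B: "lin_vars c \<subseteq> ?VA \<inter> ?VB" if c: "c \<in> S" for c
  proof -
    obtain q where q: "maximal_B_subpath \<pi> q" and c: "c = upsilon (summary q)"
      using c by (auto simp: S_def)
    obtain l r where lr: "\<pi> = l @ q @ r" "q \<noteq> []" "\<forall>e\<in>set q. side e = SideB"
        "l \<noteq> [] \<longrightarrow> side (last l) = SideA" "r \<noteq> [] \<longrightarrow> side (hd r) = SideA"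
      using q by (auto simp: maximal_B_subpath_def)
    have in_B: "base (esrc (hd q)) \<in> ?VB" "base (etgt (last q)) \<in> ?VB"
      using lr encoding_vars[OF B_edge[of "hd q"]] encoding_vars[OF B_edge[of "last q"]] by auto
    \<comment> \<open>Before \<open>q\<close> there is either an A-edge of \<open>\<pi>\<close> or
      the start of \<open>\<pi>\<close>, where the vertex belongs to \<open>x\<close>. The other end
      is symmetric.\<close>
    have src_A: "base (esrc (hd q)) \<in> ?VA"
    proof (cases "l = []")
      case True
      then show ?thesis using path_hd[OF path_pi] lr x_A by simp
    next
      case False
      then have "etgt (last l) = esrc (hd q)"
        using path_joint[of _ l "q @ r"] path_pi lr by auto
      then show ?thesis
        using encoding_vars[OF A_edge[of "last l"]] False lr by auto
    qed
    have tgt_A: "base (etgt (last q)) \<in> ?VA"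
    proof (cases "r = []")
      case True
      then show ?thesis using path_last[OF path_pi] lr x_A by simp
    next
      case False
      then have "etgt (last q) = esrc (hd r)"
        using path_joint[of _ "l @ q" r] path_pi lr by auto
      then show ?thesis
        using encoding_vars[OF A_edge[of "hd r"]] False lr by auto
    qed
    show ?thesis
      using in_B src_A tgt_A c by (simp add: lin_vars_upsilon summary_def)
  qed

  have vars_I: "lin_vars (upsilon d) \<subseteq> ?VA \<inter> ?VB" if d: "d \<in> T" for d
  proof -
    obtain p where p: "maximal_A_path C_bar p" and d: "d = summary p"
      using d by (auto simp: T_def)
    obtain m rest where m: "rotate m C_bar = p @ rest" "p \<noteq> []" "rest \<noteq> []"
        "\<forall>e\<in>set p. side e = SideA" "side (hd rest) = SideB" "side (last rest) = SideB"
      using p by (auto simp: maximal_A_path_def)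
    obtain v where v: "path v (p @ rest) v"
      using path_rotate[OF cyc, of m] m(1) by auto
    \<comment> \<open>The tightened edge need not belong to the encoding of \<open>A\<close>, but
      its only variable \<open>x\<close> occurs in \<open>A\<close>.\<close>
    have in_A: "{base (etgt e), base (esrc e)} \<subseteq> ?VA" if "e \<in> set p" for e
    proof (cases "e \<in> set \<rho>")
      case True
      then show ?thesis using encoding_vars[OF A_edge[of e]] m(4) that by auto
    next
      case False
      then have "e = (SideA, Diff (Pos x) (Neg x) (2 * k))"
        using maximal_A_path_subset(1)[OF p] that assms(21) by auto
      then show ?thesis using x_A by simp
    qed
    have "set rest \<subseteq> set C_bar"
      using arg_cong[OF m(1), of set] by auto
    then have in_B: "{base (etgt e), base (esrc e)} \<subseteq> ?VB" if "e \<in> set rest" "side e = SideB" for e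
      using encoding_vars[OF B_edge[of e]] C_bar_B that by blast
    \<comment> \<open>\<open>p @ rest\<close> is a closed walk, so both ends of \<open>p\<close> are
      also ends of the adjacent B-edges in \<open>rest\<close>.\<close>
    have "esrc (hd p) = etgt (last rest)"
      using path_hd[OF v] path_last[OF v] m by simp
    moreover have "etgt (last p) = esrc (hd rest)"
      using path_joint[OF v] m by blast
    ultimately show ?thesis
      using in_A[of "hd p"] in_A[of "last p"] in_B[of "hd rest"] in_B[of "last rest"] m d
      by (simp add: lin_vars_upsilon summary_def)
  qed

  have "atoms (Imp P_B I) = S \<union> upsilon ` T"
    by (simp add: P_B I fm.set_map atoms_conj_of fin_S fin_T)
  then have "\<Union> (lin_vars ` atoms (Imp P_B I)) \<subseteq> ?VA \<inter> ?VB"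
    using vars_P_B vars_I by blast
  then show ?thesis
    unfolding int_interpolant_def using A_implies B_refutes by blast
qed

end
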